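(* Suppose that we are confronted with two marbles with unknown weights $S<L$. One of the two marbles is chosen equiprobably and examined (measured, or compared with a randomly selected weight). Let $X$ be the weight of the examined marble and $U$ the weight of the other (unexamined) marble. Choose a random variable $r$ from a distribution with $P(r<S)=p$ and $P(r>L)=q$. The decision rule is: if $r<X$, the unexamined marble is assigned to the set $A$ (written $U\to A$), and if $r>X$, it is assigned to the set $B$ (written $U\to B$). Then $$E(U\to A)=\frac{Lp+S(1-q)}{1+p-q}<\frac{L+S}{2}<E(U\to B)=\frac{L(1-p)+qS}{1-p+q}.$$
   Context: $E(U\to A)$ denotes the expected value of the weight of an unexamined marble assigned to $A$. It is computed as $E(U\to A)=W(U\to A)/P(U\to A)$, where $P(U\to A)$ is the probability that the unexamined marble is assigned to $A$ (thought of as the fraction of a marble assigned to $A$) and $W(U\to A)$ is the total weight of that fractional marble, i.e. the sum over the two possible cases ($X=S$, $U=L$ and $X=L$, $U=S$) of the value of $U$ times the probability that the case occurs and $U\to A$. $E(U\to B)$, $P(U\to B)$ and $W(U\to B)$ are defined similarly with $B$ in place of $A$.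
   Formalization: The formal statement also assumes P(r=S)=P(r=L)=0 (the decision rule does not cover r=X, and the formulas can fail with ties) and p+q<1 (at p+q=1 the strict inequalities become equalities or a quotient is undefined); r is taken independent of X. *)

theory Defs
  imports "HOL-Probability.Probability"
begin

definition assigned_A :: "'a measure \<Rightarrow> ('a \<Rightarrow> real) \<Rightarrow> ('a \<Rightarrow> real) \<Rightarrow> 'a set" where
  "assigned_A M X r = {\<omega> \<in> space M. r \<omega> < X \<omega>}"

definition assigned_B :: "'a measure \<Rightarrow> ('a \<Rightarrow> real) \<Rightarrow> ('a \<Rightarrow> real) \<Rightarrow> 'a set" where
  "assigned_B M X r = {\<omega> \<in> space M. r \<omega> > X \<omega>}"

text \<open>The total weight and the expected weight of the unexamined marble on an assignment
  event \<open>G\<close>, which is either \<open>assigned_A M X r\<close> or \<open>assigned_B M X r\<close>.\<close>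

definition assigned_weight ::
  "'a measure \<Rightarrow> real \<Rightarrow> real \<Rightarrow> ('a \<Rightarrow> real) \<Rightarrow> ('a \<Rightarrow> real) \<Rightarrow> 'a set \<Rightarrow> real" where
  "assigned_weight M S L X U G =
     L * measure M {\<omega> \<in> space M. X \<omega> = S \<and> U \<omega> = L \<and> \<omega> \<in> G} +
     S * measure M {\<omega> \<in> space M. X \<omega> = L \<and> U \<omega> = S \<and> \<omega> \<in> G}"

definition expected_weight ::
  "'a measure \<Rightarrow> real \<Rightarrow> real \<Rightarrow> ('a \<Rightarrow> real) \<Rightarrow> ('a \<Rightarrow> real) \<Rightarrow> 'a set \<Rightarrow> real" where
  "expected_weight M S L X U G = assigned_weight M S L X U G / measure M G"

end

theory Submission
  imports Defs
begin

text \<open>Up to a null set only the cases \<open>X = S\<close>, \<open>U = L\<close> and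
  \<open>X = L\<close>, \<open>U = S\<close> occur, each with probability 1/2. As \<open>r\<close>
  is independent of \<open>X\<close>, assignment to A has probability p/2 in the first case and
  (1-q)/2 in the second, so the expected weight is the average of L and S with weights p and 1-q.
  For B the weights are 1-p and q. Since p + q < 1, that is, \<open>r\<close> falls strictly between
  S and L with positive probability, the first average leans to S and the second to L.\<close>

context prob_space
begin

text \<open>Both assignment rules have the form \<open>r \<omega> \<in> T (X \<omega>)\<close>, so
  one computation serves A and B. The common factor 1/2 of the two cases cancels in the
  quotient.\<close>

lemma expected_weight_threshold:
  fixes X U r :: "'a \<Rightarrow> real" and T :: "real \<Rightarrow> real set"
  assumes "S \<noteq> L"
    and U [measurable]: "U \<in> borel_measurable M"
    and ae: "AE \<omega> in M. (X \<omega> = S \<and> U \<omega> = L) \<or> (X \<omega> = L \<and> U \<omega> = S)"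
    and X: "prob {\<omega> \<in> space M. X \<omega> = S} = 1 / 2" "prob {\<omega> \<in> space M. X \<omega> = L} = 1 / 2"
    and indep: "indep_var borel X borel r"
    and T [measurable]: "T S \<in> sets borel" "T L \<in> sets borel"
    and G [measurable]: "{\<omega> \<in> space M. r \<omega> \<in> T (X \<omega>)} \<in> events"
  defines "a \<equiv> prob {\<omega> \<in> space M. r \<omega> \<in> T S}" and "b \<equiv> prob {\<omega> \<in> space M. r \<omega> \<in> T L}"
  shows "expected_weight M S L X U {\<omega> \<in> space M. r \<omega> \<in> T (X \<omega>)} = (L * a + S * b) / (a + b)"
proof -
  let ?G = "{\<omega> \<in> space M. r \<omega> \<in> T (X \<omega>)}"
  have [measurable]: "X \<in> borel_measurable M" "r \<in> borel_measurable M"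
    using indep by (auto dest: indep_var_rv1 indep_var_rv2)
  \<comment> \<open>Fixing the value of \<open>X\<close> turns the moving set
    \<open>T (X \<omega>)\<close> into a constant one, so the event is a rectangle for the pair of
    \<open>X\<close> and \<open>r\<close>.\<close>
  have factor: "prob {\<omega> \<in> space M. X \<omega> = x \<and> r \<omega> \<in> T x} =
      prob {\<omega> \<in> space M. X \<omega> = x} * prob {\<omega> \<in> space M. r \<omega> \<in> T x}"
    if "T x \<in> sets borel" for x
  proof -
    have "(\<lambda>\<omega>. (X \<omega>, r \<omega>)) -` ({x} \<times> T x) \<inter> space M = {\<omega> \<in> space M. X \<omega> = x \<and> r \<omega> \<in> T x}"
      "X -` {x} \<inter> space M = {\<omega> \<in> space M. X \<omega> = x}"
      "r -` T x \<inter> space M = {\<omega> \<in> space M. r \<omega> \<in> T x}"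
      by auto
    with indep_varD[OF indep, of "{x}" "T x"] that show ?thesis
      by simp
  qed
  \<comment> \<open>As S and L differ, \<open>X = S\<close> almost surely forces
    \<open>U = L\<close>, which makes the clause on \<open>U\<close> redundant.\<close>
  have 1: "prob {\<omega> \<in> space M. X \<omega> = S \<and> U \<omega> = L \<and> \<omega> \<in> ?G} =
      prob {\<omega> \<in> space M. X \<omega> = S \<and> r \<omega> \<in> T S}"
    using ae \<open>S \<noteq> L\<close> by (intro measure_eq_AE) auto
  have 2: "prob {\<omega> \<in> space M. X \<omega> = L \<and> U \<omega> = S \<and> \<omega> \<in> ?G} =
      prob {\<omega> \<in> space M. X \<omega> = L \<and> r \<omega> \<in> T L}"
    using ae \<open>S \<noteq> L\<close> by (intro measure_eq_AE) auto
  have "prob ?G = prob ({\<omega> \<in> space M. X \<omega> = S \<and> r \<omega> \<in> T S} \<union> {\<omega> \<in> space M. X \<omega> = L \<and> r \<omega> \<in> T L})"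
    using ae by (intro measure_eq_AE) auto
  also have "\<dots> = prob {\<omega> \<in> space M. X \<omega> = S \<and> r \<omega> \<in> T S} + prob {\<omega> \<in> space M. X \<omega> = L \<and> r \<omega> \<in> T L}"
    using \<open>S \<noteq> L\<close> by (intro finite_measure_Union) auto
  finally have 3: "prob ?G = (a + b) / 2"
    by (simp add: factor X a_def b_def)
  have "assigned_weight M S L X U ?G = (L * a + S * b) / 2"
    unfolding assigned_weight_def 1 2 by (simp add: factor X a_def b_def add_divide_distrib)
  then show ?thesis
    unfolding expected_weight_def 3 by simp
qed

text \<open>With no atom at \<open>c\<close>, the two events are complementary up to a null set.
  This yields P(r < L) = 1-q and P(r > S) = 1-p.\<close>

lemma prob_less_eq_one_minus_greater:
  fixes r :: "'a \<Rightarrow> real"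
  assumes [measurable]: "r \<in> borel_measurable M"
    and "prob {\<omega> \<in> space M. r \<omega> = c} = 0"
  shows "prob {\<omega> \<in> space M. r \<omega> < c} = 1 - prob {\<omega> \<in> space M. r \<omega> > c}"
proof -
  have "AE \<omega> in M. r \<omega> \<noteq> c"
    using assms(2) by (subst (asm) prob_eq_0) auto
  then have "prob {\<omega> \<in> space M. r \<omega> < c} = prob (space M - {\<omega> \<in> space M. r \<omega> > c})"
    by (intro measure_eq_AE) auto
  also have "\<dots> = 1 - prob {\<omega> \<in> space M. r \<omega> > c}"
    by (intro prob_compl) measurable
  finally show ?thesis .
qed

end

theorem lemma1:
  fixes M :: "'a measure" and X U r :: "'a \<Rightarrow> real" and S L p q :: real
  assumes "prob_space M"
    and "S < L"
    and "U \<in> borel_measurable M"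
    and "AE \<omega> in M. (X \<omega> = S \<and> U \<omega> = L) \<or> (X \<omega> = L \<and> U \<omega> = S)"
    and "measure M {\<omega> \<in> space M. X \<omega> = S} = 1 / 2"
    and "measure M {\<omega> \<in> space M. X \<omega> = L} = 1 / 2"
    and "prob_space.indep_var M borel X borel r"
    and "measure M {\<omega> \<in> space M. r \<omega> < S} = p"
    and "measure M {\<omega> \<in> space M. r \<omega> > L} = q"
    and "measure M {\<omega> \<in> space M. r \<omega> = S} = 0"
    and "measure M {\<omega> \<in> space M. r \<omega> = L} = 0"
    and "p + q < 1"
  shows "expected_weight M S L X U (assigned_A M X r) = (L * p + S * (1 - q)) / (1 + p - q)
       \<and> (L * p + S * (1 - q)) / (1 + p - q) < (L + S) / 2
       \<and> (L + S) / 2 < expected_weight M S L X U (assigned_B M X r)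
       \<and> expected_weight M S L X U (assigned_B M X r) = (L * (1 - p) + q * S) / (1 - p + q)"
proof -
  interpret prob_space M by fact
  have [measurable]: "X \<in> borel_measurable M" "r \<in> borel_measurable M"
    using assms(7) by (auto dest: indep_var_rv1 indep_var_rv2)
  note threshold = expected_weight_threshold[OF _ assms(3-7)]
  \<comment> \<open>For \<open>{..<x}\<close> the two weights are \<open>a = p\<close> and
    \<open>b = 1 - q\<close>.\<close>
  have "expected_weight M S L X U (assigned_A M X r) = (L * p + S * (1 - q)) / (p + (1 - q))"
    using threshold[of "\<lambda>x. {..<x}"] \<open>S < L\<close> assms(8,9)
      prob_less_eq_one_minus_greater[of r L] assms(11)
    by (simp add: assigned_A_def)
  then have A: "expected_weight M S L X U (assigned_A M X r) = (L * p + S * (1 - q)) / (1 + p - q)"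
    by (simp add: algebra_simps)
  have "measure M {\<omega> \<in> space M. r \<omega> > S} = 1 - p"
    using prob_less_eq_one_minus_greater[of r S] assms(8,10) by simp
  then have B: "expected_weight M S L X U (assigned_B M X r) = (L * (1 - p) + q * S) / (1 - p + q)"
    using threshold[of "\<lambda>x. {x<..}"] \<open>S < L\<close> assms(9)
    by (simp add: assigned_B_def mult.commute)
  have "p \<ge> 0" "q \<ge> 0"
    unfolding assms(8,9)[symmetric] by simp_all
  then have pos: "1 + p - q > 0" "1 - p + q > 0"
    using \<open>p + q < 1\<close> by linarith+
  \<comment> \<open>After clearing denominators, right side minus left side is exactly this product
    in both inequalities below.\<close>
  have gap: "(L - S) * (1 - p - q) > 0"
    using \<open>S < L\<close> \<open>p + q < 1\<close> by simp
  have "(L * p + S * (1 - q)) / (1 + p - q) < (L + S) / 2"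
    using gap pos by (simp add: field_simps)
  moreover have "(L + S) / 2 < (L * (1 - p) + q * S) / (1 - p + q)"
    using gap pos by (simp add: field_simps)
  ultimately show ?thesis
    using A B by simp
qed

end
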